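(* Let $\kappa_2,\kappa_3$ be arbitrary parameters. For $\alpha,\beta\in\mathbb{C}$ consider the non-abelian system (with $z$ a central parameter) $$\frac{du}{dt}=-u^2+2uv+\alpha[u,v]-2zu+\kappa_2,\qquad \frac{dv}{dt}=-v^2+2vu+\beta[v,u]+2zv+\kappa_3 .$$ There are exactly six pairs $(\alpha,\beta)$ for which this system has a non-abelian first integral of the form $$J=a_1uv^2+(1-a_1-a_2)vuv+a_2v^2u+b_1u^2v+(-1-b_1-b_2)uvu+b_2vu^2-\kappa_3u+\kappa_2v+z\big(c_1uv+(-2-c_1)vu\big),$$ for some coefficients $a_1,a_2,b_1,b_2,c_1$ independent of $u,v,z$, namely $$(\alpha,\beta)\in\{(-2,-1),\,(-2,0),\,(-1,-2),\,(-1,0),\,(0,-2),\,(0,-1)\}.$$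
   Context: "Arbitrary parameters" means that $\kappa_2,\kappa_3$ are algebraically independent indeterminates over $\mathbb{C}$; let $K$ be an algebraic closure of $\mathbb{C}(\kappa_2,\kappa_3)$, in which the coefficients $a_i,b_i,c_1$ of $J$ lie. The variables $u,v$ are generators of the free unital associative algebra $\mathcal{A}=K[z]\langle u,v\rangle$, $z$ is a central indeterminate, and $[x,y]=xy-yx$. A system $du/dt=F_1,\ dv/dt=F_2$ denotes the $K[z]$-linear derivation $d_t$ of $\mathcal{A}$ with $d_t(u)=F_1$, $d_t(v)=F_2$. An element $J\in\mathcal{A}$ is a non-abelian first integral if $d_t(J)=0$ in $\mathcal{A}$. (The system is the auxiliary autonomous system of a non-abelian Painlevé-4 system, obtained from it by replacing $d/dz$ by $d/dt$ and regarding $z$ as a parameter.) *)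

theory Defs
  imports
    "HOL-Library.Poly_Mapping"
    "HOL-Algebra.Algebraic_Closure_Type"
begin

section \<open>The free associative algebra on two generators\<close>

datatype letter = U | V

datatype word = Word (letters: "letter list")

text \<open>
  The free monoid on \<open>U\<close>, \<open>V\<close>, written additively: with this instance the multiplication of
  \<^typ>\<open>word \<Rightarrow>\<^sub>0 'r\<close> is the convolution product over concatenation of words.
\<close>

instantiation word :: monoid_add
begin

definition "0 = Word []"

definition "w + w' = Word (letters w @ letters w')"

instance
  by standard (simp_all add: zero_word_def plus_word_def)

end

type_synonym 'r free_alg = "word \<Rightarrow>\<^sub>0 'r"

definition scalar :: "'r::comm_ring_1 \<Rightarrow> 'r free_alg" where
  "scalar r = Poly_Mapping.single 0 r"

definition gen :: "letter \<Rightarrow> 'r::comm_ring_1 free_alg" where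
  "gen x = Poly_Mapping.single (Word [x]) 1"

definition commutator :: "'a::ring \<Rightarrow> 'a \<Rightarrow> 'a" where
  "commutator x y = x * y - y * x"


section \<open>Derivations and non-abelian first integrals\<close>

definition derivation :: "('r::comm_ring_1 free_alg \<Rightarrow> 'r free_alg) \<Rightarrow> bool" where
  "derivation D \<longleftrightarrow>
     (\<forall>x y. D (x + y) = D x + D y) \<and>
     (\<forall>r x. D (scalar r * x) = scalar r * D x) \<and>
     (\<forall>x y. D (x * y) = D x * y + x * D y)"

definition system_derivation ::
  "'r::comm_ring_1 free_alg \<Rightarrow> 'r free_alg \<Rightarrow> 'r free_alg \<Rightarrow> 'r free_alg" where
  "system_derivation F1 F2 = (THE D. derivation D \<and> D (gen U) = F1 \<and> D (gen V) = F2)"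

definition first_integral ::
  "'r::comm_ring_1 free_alg \<Rightarrow> 'r free_alg \<Rightarrow> 'r free_alg \<Rightarrow> bool" where
  "first_integral F1 F2 J \<longleftrightarrow> system_derivation F1 F2 J = 0"

text \<open>The description in \<^const>\<open>system_derivation\<close> is proper.\<close>

lemma word_add [simp]: "Word xs + Word ys = Word (xs @ ys)"
  by (simp add: plus_word_def)

lemma scalar_mult_single: "scalar r * Poly_Mapping.single w s = Poly_Mapping.single w (r * s)"
  by (simp add: scalar_def mult_single)

lemma free_alg_induct [case_names single add]:
  fixes f :: "'r::comm_ring_1 free_alg"
  assumes "\<And>w r. P (Poly_Mapping.single w r)"
    and "\<And>f g. P f \<Longrightarrow> P g \<Longrightarrow> P (f + g)"
  shows "P f"
proof (induction f rule: Poly_Mapping.update_induct)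
  case const
  show ?case using assms(1)[of 0 0] by simp
next
  case (update f w r)
  have "Poly_Mapping.update w r f = f + Poly_Mapping.single w r"
    using update(1)
    by (intro poly_mapping_eqI)
       (auto simp: lookup_update lookup_add lookup_single when_def in_keys_iff)
  then show ?case using assms(1)[of w r] assms(2) update by simp
qed

fun word_deriv :: "(letter \<Rightarrow> 'r::comm_ring_1 free_alg) \<Rightarrow> letter list \<Rightarrow> 'r free_alg" where
  "word_deriv F [] = 0"
| "word_deriv F (x # xs) =
     F x * Poly_Mapping.single (Word xs) 1 + gen x * word_deriv F xs"

lemma gen_times_word:
  "gen x * Poly_Mapping.single (Word xs) 1 =
     (Poly_Mapping.single (Word (x # xs)) 1 :: 'r::comm_ring_1 free_alg)"
  by (simp add: gen_def mult_single)

lemma word_deriv_append: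
  "word_deriv F (xs @ ys) =
     word_deriv F xs * Poly_Mapping.single (Word ys) 1 +
     Poly_Mapping.single (Word xs) 1 * word_deriv F ys"
proof (induction xs)
  case Nil
  have "Poly_Mapping.single (Word []) (1::'a) = 1"
    by (simp flip: zero_word_def)
  then show ?case by simp
next
  case (Cons x xs)
  have "Poly_Mapping.single (Word xs) 1 * Poly_Mapping.single (Word ys) 1 =
      (Poly_Mapping.single (Word (xs @ ys)) 1 :: 'a free_alg)"
    by (simp add: mult_single)
  then show ?case
    using Cons by (simp add: algebra_simps flip: gen_times_word)
qed

definition ext_deriv ::
  "(letter \<Rightarrow> 'r::comm_ring_1 free_alg) \<Rightarrow> 'r free_alg \<Rightarrow> 'r free_alg" where
  "ext_deriv F f =
     (\<Sum>w\<in>Poly_Mapping.keys f. scalar (Poly_Mapping.lookup f w) * word_deriv F (letters w))"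

lemma scalar_simps [simp]:
  "scalar 0 = 0" "scalar 1 = 1" "scalar (r + s) = scalar r + scalar s"
  "scalar (r * s) = scalar r * scalar s"
  by (simp_all add: scalar_def single_add mult_single)

lemma scalar_central: "scalar r * x = x * scalar r"
proof (induction x rule: free_alg_induct)
  case (single w s)
  then show ?case by (simp add: scalar_def mult_single mult.commute)
qed (simp add: algebra_simps)

lemma ext_deriv_superset:
  assumes "finite A" "Poly_Mapping.keys f \<subseteq> A"
  shows "ext_deriv F f =
    (\<Sum>w\<in>A. scalar (Poly_Mapping.lookup f w) * word_deriv F (letters w))"
  unfolding ext_deriv_def
  by (rule sum.mono_neutral_left) (use assms in \<open>auto simp: in_keys_iff\<close>)

lemma ext_deriv_add: "ext_deriv F (f + g) = ext_deriv F f + ext_deriv F g"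
proof -
  let ?A = "Poly_Mapping.keys f \<union> Poly_Mapping.keys g"
  have "Poly_Mapping.keys (f + g) \<subseteq> ?A" by (rule Poly_Mapping.keys_add)
  then show ?thesis
    by (simp add: ext_deriv_superset[of ?A] lookup_add sum.distrib algebra_simps)
qed

lemma ext_deriv_single:
  "ext_deriv F (Poly_Mapping.single w r) = scalar r * word_deriv F (letters w)"
  by (simp add: ext_deriv_superset[of "{w}"])

lemma ext_deriv_scalar: "ext_deriv F (scalar r * f) = scalar r * ext_deriv F f"
  by (induction f rule: free_alg_induct)
     (simp_all add: scalar_mult_single ext_deriv_single ext_deriv_add distrib_left mult.assoc)

lemma ext_deriv_mult: "ext_deriv F (f * g) = ext_deriv F f * g + f * ext_deriv F g"
proof (induction f rule: free_alg_induct)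
  case (single w r)
  show ?case
  proof (induction g rule: free_alg_induct)
    case (single w' s)
    have 1: "Poly_Mapping.single w r = scalar r * Poly_Mapping.single (Word (letters w)) 1"
      by (simp add: scalar_mult_single)
    have 2: "Poly_Mapping.single w' s = scalar s * Poly_Mapping.single (Word (letters w')) 1"
      by (simp add: scalar_mult_single)
    have "ext_deriv F (Poly_Mapping.single w r * Poly_Mapping.single w' s) =
        scalar r * scalar s * word_deriv F (letters w @ letters w')"
      by (simp add: mult_single ext_deriv_single plus_word_def)
    also have "\<dots> = scalar r * (scalar s * word_deriv F (letters w)) *
          Poly_Mapping.single (Word (letters w')) 1 +
        scalar r * (scalar s * Poly_Mapping.single (Word (letters w)) 1) *
          word_deriv F (letters w')"
      by (simp add: word_deriv_append distrib_left mult.assoc)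
    also have "\<dots> = ext_deriv F (Poly_Mapping.single w r) * Poly_Mapping.single w' s +
        Poly_Mapping.single w r * ext_deriv F (Poly_Mapping.single w' s)"
      unfolding scalar_central[of s] by (simp add: 1 2 ext_deriv_single ext_deriv_scalar mult.assoc)
    finally show ?case .
  qed (simp add: ext_deriv_add algebra_simps)
qed (simp add: ext_deriv_add algebra_simps)

lemma ext_deriv_gen: "ext_deriv F (gen x) = F x"
  by (simp add: gen_def ext_deriv_single flip: zero_word_def)

lemma derivation_ext_deriv: "derivation (ext_deriv F)"
  unfolding derivation_def using ext_deriv_add ext_deriv_scalar ext_deriv_mult by blast

lemma derivation_unique:
  fixes D D' :: "'r::comm_ring_1 free_alg \<Rightarrow> 'r free_alg"
  assumes "derivation D" "derivation D'" and eq: "\<And>x. D (gen x) = D' (gen x)"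
  shows "D = D'"
proof
  have one: "E 1 = 0" if "derivation E" for E :: "'r free_alg \<Rightarrow> 'r free_alg"
  proof -
    have "E (1 * 1) = E 1 * 1 + 1 * E 1" using that unfolding derivation_def by blast
    then show ?thesis by simp
  qed
  have word: "D (Poly_Mapping.single (Word xs) 1) = D' (Poly_Mapping.single (Word xs) 1)" for xs
  proof (induction xs)
    case Nil
    then show ?case using one[OF assms(1)] one[OF assms(2)] by (simp flip: zero_word_def)
  next
    case (Cons x xs)
    then show ?case
      using assms(1,2) eq[of x] unfolding derivation_def gen_times_word[symmetric] by simp
  qed
  show "D f = D' f" for f
  proof (induction f rule: free_alg_induct)
    case (single w r)
    have "Poly_Mapping.single w r = scalar r * Poly_Mapping.single (Word (letters w)) 1"
      by (simp add: scalar_mult_single)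
    then show ?case using assms(1,2) word[of "letters w"] unfolding derivation_def by metis
  next
    case (add f g)
    then show ?case using assms(1,2) unfolding derivation_def by simp
  qed
qed

theorem ex1_system_derivation:
  fixes F1 F2 :: "'r::comm_ring_1 free_alg"
  shows "\<exists>!D. derivation D \<and> D (gen U) = F1 \<and> D (gen V) = F2"
proof (rule ex1I)
  let ?D = "ext_deriv (\<lambda>x. case x of U \<Rightarrow> F1 | V \<Rightarrow> F2)"
  show *: "derivation ?D \<and> ?D (gen U) = F1 \<and> ?D (gen V) = F2"
    by (simp add: derivation_ext_deriv ext_deriv_gen)
  fix D assume D: "derivation D \<and> D (gen U) = F1 \<and> D (gen V) = F2"
  show "D = ?D"
  proof (rule derivation_unique)
    show "D (gen x) = ?D (gen x)" for x
      using D * by (cases x) simp_all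
  qed (use D * in blast)+
qed

lemma system_derivation:
  "derivation (system_derivation F1 F2)"
  "system_derivation F1 F2 (gen U) = F1"
  "system_derivation F1 F2 (gen V) = F2"
  using theI'[OF ex1_system_derivation[of F1 F2]] unfolding system_derivation_def by blast+


section \<open>The coefficient field and the system\<close>

text \<open>
  \<^typ>\<open>complex poly poly fract\<close> is the field of rational functions over \<open>\<complex>\<close> in two indeterminates:
  the variable of the inner polynomial ring is \<open>\<kappa>\<^sub>2\<close>, that of the outer one is \<open>\<kappa>\<^sub>3\<close>.
\<close>

type_synonym coeff_field = "complex poly poly fract alg_closure"

definition of_complex :: "complex \<Rightarrow> coeff_field" where
  "of_complex c = to_ac (Fraction_Field.Fract [:[:c:]:] 1)"

definition kappa2 :: coeff_field where
  "kappa2 = to_ac (Fraction_Field.Fract [:[:0, 1:]:] 1)"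

definition kappa3 :: coeff_field where
  "kappa3 = to_ac (Fraction_Field.Fract [:0, 1:] 1)"

text \<open>The base ring of the algebra is \<open>K[z]\<close>, with \<open>K\<close> = \<^typ>\<open>coeff_field\<close>.\<close>

type_synonym nc_alg = "coeff_field poly free_alg"

abbreviation const :: "coeff_field \<Rightarrow> nc_alg" where
  "const c \<equiv> scalar [:c:]"

abbreviation z :: nc_alg where
  "z \<equiv> scalar [:0, 1:]"

abbreviation u :: nc_alg where
  "u \<equiv> gen U"

abbreviation v :: nc_alg where
  "v \<equiv> gen V"

definition rhs_u :: "complex \<Rightarrow> nc_alg" where
  "rhs_u \<alpha> = - (u ^ 2) + 2 * u * v + const (of_complex \<alpha>) * commutator u v - 2 * z * u + const kappa2"

definition rhs_v :: "complex \<Rightarrow> nc_alg" where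
  "rhs_v \<beta> = - (v ^ 2) + 2 * v * u + const (of_complex \<beta>) * commutator v u + 2 * z * v + const kappa3"

definition ansatz ::
  "coeff_field \<Rightarrow> coeff_field \<Rightarrow> coeff_field \<Rightarrow> coeff_field \<Rightarrow> coeff_field \<Rightarrow> nc_alg" where
  "ansatz a1 a2 b1 b2 c1 =
     const a1 * u * v ^ 2 + const (1 - a1 - a2) * v * u * v + const a2 * v ^ 2 * u
     + const b1 * u ^ 2 * v + const (- 1 - b1 - b2) * u * v * u + const b2 * v * u ^ 2
     - const kappa3 * u + const kappa2 * v
     + z * (const c1 * u * v + const (- 2 - c1) * v * u)"

end

theory Submission
  imports Defs
begin

text \<open>
  The derivative of the ansatz is a combination of monomials in \<open>u\<close>, \<open>v\<close>, and it vanishes iff all its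
  coefficients do. The top-degree coefficients give \<open>b1 (\<beta> + 2) = b2 \<beta> = a1 \<alpha> = a2 (\<alpha> + 2) = 0\<close>, and
  distinguishing \<open>\<beta> = 0\<close>, \<open>\<beta> = -2\<close> and all other values (which forces \<open>b1 = b2 = 0\<close> and \<open>\<beta> = -1\<close>),
  the remaining top-degree coefficients leave two values of \<open>\<alpha>\<close> in each case. Conversely, in each of
  the six cases the coefficients of the ansatz read off along the way, with a suitable \<open>c1\<close>, also
  annihilate the lower-degree terms.
\<close>

abbreviation mon :: "letter list \<Rightarrow> 'r \<Rightarrow> 'r::comm_ring_1 free_alg" where
  "mon w r \<equiv> Poly_Mapping.single (Word w) r"

text \<open>Together with distributivity these rules turn any expression in the generators and
  scalars into a sum of monomials.\<close>

lemma monomial_simps: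
  "scalar r = mon [] r" "gen x = mon [x] 1" "2 = mon [] 2"
  "mon xs r * mon ys s = mon (xs @ ys) (r * s)"
  "- mon xs r = mon xs (- r)"
  "p - mon ys s = p + mon ys (- s)"
  by (simp_all add: scalar_def gen_def mult_single single_uminus flip: zero_word_def)

lemma lookup_single_if:
  "Poly_Mapping.lookup (Poly_Mapping.single k r) w = (if w = k then r else 0)"
  by (simp add: lookup_single when_def)

text \<open>A derivation is fixed by its values on the generators, so the definite description can
  be replaced by an explicit formula that can be computed.\<close>

lemma system_derivation_eq_ext_deriv:
  "system_derivation F1 F2 = ext_deriv (case_letter F1 F2)"
proof (rule derivation_unique)
  show "system_derivation F1 F2 (gen x) = ext_deriv (case_letter F1 F2) (gen x)" for x
    by (cases x) (simp_all add: system_derivation ext_deriv_gen)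
qed (simp_all add: system_derivation derivation_ext_deriv)

text \<open>Expanded into monomials over an arbitrary commutative ring, with \<open>t\<close> for
  the central \<open>z\<close> and \<open>k\<close> for \<open>kappa2\<close>, so that the
  computation takes place away from the concrete coefficient field. Below, \<open>l\<close> stands
  for \<open>kappa3\<close> in the ansatz.\<close>

definition normal_rhs_u :: "'r \<Rightarrow> 'r \<Rightarrow> 'r \<Rightarrow> 'r::comm_ring_1 free_alg" where
  "normal_rhs_u \<alpha> t k =
     mon [U,U] (- 1) + mon [U,V] (2 + \<alpha>) + mon [V,U] (- \<alpha>) + mon [U] (- 2 * t) + mon [] k"

definition normal_rhs_v :: "'r \<Rightarrow> 'r \<Rightarrow> 'r \<Rightarrow> 'r::comm_ring_1 free_alg" where
  "normal_rhs_v \<beta> t k =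
     mon [V,V] (- 1) + mon [V,U] (2 + \<beta>) + mon [U,V] (- \<beta>) + mon [V] (2 * t) + mon [] k"

definition normal_ansatz ::
  "'r \<Rightarrow> 'r \<Rightarrow> 'r \<Rightarrow> 'r \<Rightarrow> 'r \<Rightarrow> 'r \<Rightarrow> 'r \<Rightarrow> 'r \<Rightarrow> 'r::comm_ring_1 free_alg" where
  "normal_ansatz t k l a1 a2 b1 b2 c1 =
     mon [U,V,V] a1 + mon [V,U,V] (1 - a1 - a2) + mon [V,V,U] a2
     + mon [U,U,V] b1 + mon [U,V,U] (- 1 - b1 - b2) + mon [V,U,U] b2
     + mon [U] (- l) + mon [V] k + mon [U,V] (t * c1) + mon [V,U] (t * (- 2 - c1))"

lemma rhs_u_eq: "rhs_u \<alpha> = normal_rhs_u [:of_complex \<alpha>:] [:0, 1:] [:kappa2:]"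
  unfolding rhs_u_def normal_rhs_u_def commutator_def
  by (simp add: monomial_simps power2_eq_square distrib_left distrib_right)
     (simp add: algebra_simps single_add single_uminus)

lemma rhs_v_eq: "rhs_v \<beta> = normal_rhs_v [:of_complex \<beta>:] [:0, 1:] [:kappa3:]"
  unfolding rhs_v_def normal_rhs_v_def commutator_def
  by (simp add: monomial_simps power2_eq_square distrib_left distrib_right)
     (simp add: algebra_simps single_add single_uminus)

lemma ansatz_eq:
  "ansatz a1 a2 b1 b2 c1 =
     normal_ansatz [:0, 1:] [:kappa2:] [:kappa3:] [:a1:] [:a2:] [:b1:] [:b2:] [:c1:]"
  unfolding ansatz_def normal_ansatz_def
  by (simp add: monomial_simps power2_eq_square distrib_left) (simp add: one_pCons numeral_poly)

text \<open>The Leibniz rule makes the left side a finite sum of monomials, so coefficients can be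
  compared word by word. Words of length 2 carry \<open>k\<close> and \<open>l\<close>, those of
  length 3 carry \<open>t\<close>, those of length 4 neither.\<close>

lemma ext_deriv_normal_ansatz:
  fixes \<alpha> \<beta> t k l a1 a2 b1 b2 c1 :: "'r::comm_ring_1"
  shows "ext_deriv (case_letter (normal_rhs_u \<alpha> t k) (normal_rhs_v \<beta> t l))
      (normal_ansatz t k l a1 a2 b1 b2 c1) =
      mon [U,V] ((a1 - a2 - \<alpha> - 1) * l + (b1 - b2 - \<beta> - 1) * k)
      + mon [V,U] (- ((a1 - a2 - \<alpha> - 1) * l + (b1 - b2 - \<beta> - 1) * k))
      + mon [U,U,V] (- t * (2 * b1 + (\<beta> + 1) * c1))
      + mon [U,V,U] (2 * t * (b1 + b2 + (\<beta> + 1) * (c1 + 1)))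
      + mon [U,V,V] (t * (2 * a1 + (\<alpha> + 1) * c1))
      + mon [V,U,U] (- t * (2 * b2 + (\<beta> + 1) * (c1 + 2)))
      + mon [V,U,V] (- 2 * t * (a1 + a2 + (\<alpha> + 1) * (c1 + 1)))
      + mon [V,V,U] (t * (2 * a2 + (\<alpha> + 1) * (c1 + 2)))
      + mon [U,U,U,V] (- (b1 * (\<beta> + 2)))
      + mon [U,U,V,U] ((\<beta> + 1) * (2 * b1 + b2 + 1) + b1)
      + mon [U,U,V,V] ((\<alpha> + 1) * b1 - (\<beta> + 1) * a1)
      + mon [U,V,U,U] (b2 - (\<beta> + 1) * (b1 + 2 * b2 + 1))
      + mon [U,V,U,V] (2 * (a1 - b2 - 1) + \<beta> * (a1 + a2 - 1) - \<alpha> * (b1 + b2 + 1))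
      + mon [U,V,V,U] (2 * a1 + \<beta> * (a1 - a2) - b1 - b2 - 1)
      + mon [U,V,V,V] (a1 * \<alpha>)
      + mon [V,U,U,U] (b2 * \<beta>)
      + mon [V,U,U,V] (1 + 2 * b2 - a1 - a2 - \<alpha> * (b1 - b2))
      + mon [V,U,V,U] (\<alpha> * (b1 + b2 + 1) - 2 * (a1 - b2 - 1) - \<beta> * (a1 + a2 - 1))
      + mon [V,U,V,V] (a1 - (\<alpha> + 1) * (2 * a1 + a2 - 1))
      + mon [V,V,U,U] ((\<beta> + 1) * a2 - (\<alpha> + 1) * b2)
      + mon [V,V,U,V] ((\<alpha> + 1) * (a1 + 2 * a2 - 1) + a2)
      + mon [V,V,V,U] (- (a2 * (\<alpha> + 2)))"
    (is "?L = ?R")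
proof (rule poly_mapping_eqI)
  fix w
  \<comment> \<open>The words not in \<open>?R\<close> are those whose coefficients cancel in \<open>?L\<close>.\<close>
  let ?W = "{Word [U,V], Word [V,U], Word [U,U,V], Word [U,V,U], Word [U,V,V], Word [V,U,U],
      Word [V,U,V], Word [V,V,U], Word [U,U,U,V], Word [U,U,V,U], Word [U,U,V,V],
      Word [U,V,U,U], Word [U,V,U,V], Word [U,V,V,U], Word [U,V,V,V], Word [V,U,U,U],
      Word [V,U,U,V], Word [V,U,V,U], Word [V,U,V,V], Word [V,V,U,U], Word [V,V,U,V],
      Word [V,V,V,U], Word [], Word [U], Word [V], Word [U,U], Word [V,V]}"
  show "Poly_Mapping.lookup ?L w = Poly_Mapping.lookup ?R w"
    apply (simp only: normal_ansatz_def ext_deriv_add ext_deriv_single word_deriv.simps word.sel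
        letter.case)
    apply (simp only: normal_rhs_u_def normal_rhs_v_def mult_zero_left mult_zero_right add_0_right
        monomial_simps mult_1_right mult_1_left)
    apply (simp only: distrib_left distrib_right append.simps monomial_simps mult_1_right
        mult_1_left lookup_add lookup_single_if)
    \<comment> \<open>Each word of \<open>?W\<close> leaves a ring identity in the parameters; for
      any other word every conditional is false and both sides are 0.\<close>
    apply (cases "w \<in> ?W")
    subgoal
      apply (simp only: insert_iff empty_iff simp_thms)
      apply (elim disjE; hypsubst)
      apply (simp_all only: word.inject list.inject letter.distinct simp_thms list.distinct
          if_True if_False add_0_left add_0_right)
      apply (simp_all add: algebra_simps)
      done
    subgoal
      by (simp only: insert_iff empty_iff simp_thms de_Morgan_disj if_False add_0_left add_0_right)
    done
qed

text \<open>The coefficients of words of length 4 already determine the pairs. The ring is an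
  integral domain so that vanishing products split.\<close>

lemma parameters_of_first_integral:
  fixes \<alpha> \<beta> t k l a1 a2 b1 b2 c1 :: "'r::idom"
  assumes two: "(2::'r) \<noteq> 0"
    and "first_integral (normal_rhs_u \<alpha> t k) (normal_rhs_v \<beta> t l)
      (normal_ansatz t k l a1 a2 b1 b2 c1)"
  shows "(\<alpha>, \<beta>) \<in> {(-2, -1), (-2, 0), (-1, -2), (-1, 0), (0, -2), (0, -1)}"
proof -
  have "Poly_Mapping.lookup (ext_deriv (case_letter (normal_rhs_u \<alpha> t k) (normal_rhs_v \<beta> t l))
      (normal_ansatz t k l a1 a2 b1 b2 c1))
      (Word w) = 0" for w
    using assms(2) by (simp add: first_integral_def system_derivation_eq_ext_deriv)
  note * = this[unfolded ext_deriv_normal_ansatz lookup_add lookup_single_if]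
  have uuuv: "b1 * (\<beta> + 2) = 0"
    using *[of "[U,U,U,V]"] by simp
  have uuvu: "(\<beta> + 1) * (2 * b1 + b2 + 1) + b1 = 0"
    using *[of "[U,U,V,U]"] by simp
  have uuvv: "(\<alpha> + 1) * b1 - (\<beta> + 1) * a1 = 0"
    using *[of "[U,U,V,V]"] by simp
  have uvuv: "2 * (a1 - b2 - 1) + \<beta> * (a1 + a2 - 1) - \<alpha> * (b1 + b2 + 1) = 0"
    using *[of "[U,V,U,V]"] by simp
  have uvvu: "2 * a1 + \<beta> * (a1 - a2) - b1 - b2 - 1 = 0"
    using *[of "[U,V,V,U]"] by simp
  have uvvv: "a1 * \<alpha> = 0"
    using *[of "[U,V,V,V]"] by simp
  have vuuu: "b2 * \<beta> = 0"
    using *[of "[V,U,U,U]"] by simp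
  have vvuu: "(\<beta> + 1) * a2 - (\<alpha> + 1) * b2 = 0"
    using *[of "[V,V,U,U]"] by simp
  have vvvu: "a2 * (\<alpha> + 2) = 0"
    using *[of "[V,V,V,U]"] by simp
  consider "\<beta> = 0" | "\<beta> = - 2" | "b1 = 0" "b2 = 0"
    using uuuv vuuu by (auto simp: eq_neg_iff_add_eq_0)
  then show ?thesis
  proof cases
    case 1
    then have "b1 = 0" using uuuv two by simp
    then have "b2 = - 1" "a1 = 0" using 1 uuvu uuvv by (simp_all add: eq_neg_iff_add_eq_0)
    moreover have "a2 = (\<alpha> + 1) * b2" using 1 vvuu by simp
    ultimately have "\<alpha> = - a2 - 1" by simp
    \<comment> \<open>Here \<open>a2 = 0\<close> gives \<open>\<alpha> = - 1\<close>, the other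
      factor \<open>\<alpha> = - 2\<close>.\<close>
    then show ?thesis using 1 vvvu by (auto simp: eq_neg_iff_add_eq_0)
  next
    case 2
    then have "b2 = 0" using vuuu two by simp
    then have "(\<beta> + 1) * (2 * b1 + b2 + 1) + b1 = - (b1 + 1)" using 2 by simp
    then have "b1 = - 1" using uuvu
      by (simp only: neg_equal_0_iff_equal eq_neg_iff_add_eq_0 add_0_left)
    then have "a1 = \<alpha> + 1" using 2 uuvv by (simp add: algebra_simps)
    then show ?thesis using 2 uvvv by (auto simp: eq_neg_iff_add_eq_0)
  next
    case 3
    then have \<beta>: "\<beta> = - 1" using uuvu by (simp add: eq_neg_iff_add_eq_0)
    then have "a1 + a2 = 1" using 3 uvvu by (simp add: algebra_simps)
    then have "\<alpha> = 2 * (a1 - 1)" using 3 \<beta> uvuv by simp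
    \<comment> \<open>Here \<open>a1 = 0\<close> gives \<open>\<alpha> = - 2\<close>, the other
      factor \<open>\<alpha> = 0\<close>.\<close>
    then show ?thesis using \<beta> uvvv by auto
  qed
qed

text \<open>The \<open>a\<close> and \<open>b\<close> values are those forced by the length 4 words.
  Then \<open>c1\<close> solves \<open>2 * a1 + (\<alpha> + 1) * c1 = 0\<close>, or
  \<open>2 * b1 + (\<beta> + 1) * c1 = 0\<close> when \<open>\<alpha> = - 1\<close>. In all six
  cases \<open>a1 - a2 = \<alpha> + 1\<close> and \<open>b1 - b2 = \<beta> + 1\<close>, which
  removes the terms in \<open>k\<close> and \<open>l\<close>.\<close>

lemma first_integral_cases:
  fixes t k l :: "'r::comm_ring_1"
  shows
    "first_integral (normal_rhs_u (- 2) t k) (normal_rhs_v (- 1) t l)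
      (normal_ansatz t k l 0 1 0 0 0)"
    "first_integral (normal_rhs_u (- 2) t k) (normal_rhs_v 0 t l)
      (normal_ansatz t k l 0 1 0 (- 1) 0)"
    "first_integral (normal_rhs_u (- 1) t k) (normal_rhs_v (- 2) t l)
      (normal_ansatz t k l 0 0 (- 1) 0 (- 2))"
    "first_integral (normal_rhs_u (- 1) t k) (normal_rhs_v 0 t l)
      (normal_ansatz t k l 0 0 0 (- 1) 0)"
    "first_integral (normal_rhs_u 0 t k) (normal_rhs_v (- 2) t l)
      (normal_ansatz t k l 1 0 (- 1) 0 (- 2))"
    "first_integral (normal_rhs_u 0 t k) (normal_rhs_v (- 1) t l)
      (normal_ansatz t k l 1 0 0 0 (- 2))"
  by (simp_all add: first_integral_def system_derivation_eq_ext_deriv ext_deriv_normal_ansatz)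

text \<open>Injectivity brings equations for the parameters, solved in the polynomial ring over the
  coefficient field, back to the complex numbers.\<close>

lemma of_complex_eq_iff: "of_complex a = of_complex b \<longleftrightarrow> a = b"
  by (simp add: of_complex_def eq_fract)

lemma of_complex_values:
  "of_complex 0 = 0" "of_complex 1 = 1" "of_complex (- 1) = - 1" "of_complex 2 = 2"
  "of_complex (- 2) = - 2"
proof -
  have hom: "of_complex 0 = 0" "of_complex 1 = 1" "\<And>a. of_complex (- a) = - of_complex a"
    "\<And>a b. of_complex (a + b) = of_complex a + of_complex b"
    by (simp_all add: of_complex_def Zero_fract_def One_fract_def one_pCons
        flip: to_ac_add to_ac_minus to_ac_0 to_ac_1)
  from hom show "of_complex 0 = 0" "of_complex 1 = 1" by simp_all
  from hom show "of_complex (- 1) = - 1" by simp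
  show two: "of_complex 2 = 2" using hom(4)[of 1 1] hom(2) by simp
  show "of_complex (- 2) = - 2" unfolding hom(3) two ..
qed

theorem proposition3:
  fixes S :: "(complex \<times> complex) set"
  defines "S \<equiv> {(\<alpha>, \<beta>). \<exists>a1 a2 b1 b2 c1. first_integral (rhs_u \<alpha>) (rhs_v \<beta>) (ansatz a1 a2 b1 b2 c1)}"
  shows "S = {(-2, -1), (-2, 0), (-1, -2), (-1, 0), (0, -2), (0, -1)} \<and> card S = 6"
proof -
  let ?c = "\<lambda>a. [:of_complex a:]"
  have c: "?c 0 = 0" "?c 1 = 1" "?c (- 1) = - 1" "?c (- 2) = - 2"
    by (simp_all add: of_complex_values one_pCons numeral_poly)
  have c_eq: "?c a = 0 \<longleftrightarrow> a = 0" "?c a = - 1 \<longleftrightarrow> a = - 1" "?c a = - 2 \<longleftrightarrow> a = - 2" for a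
    using of_complex_eq_iff[of a 0] of_complex_eq_iff[of a "- 1"] of_complex_eq_iff[of a "- 2"]
    by (simp_all add: of_complex_values one_pCons numeral_poly)
  have "(2 :: coeff_field) \<noteq> 0"
    using of_complex_eq_iff[of 2 0] by (simp add: of_complex_values)
  then have two: "(2 :: coeff_field poly) \<noteq> 0" by (simp add: numeral_poly)
  have S: "S = {(-2, -1), (-2, 0), (-1, -2), (-1, 0), (0, -2), (0, -1)}" (is "S = ?P")
  proof (intro equalityI subrelI)
    fix \<alpha> \<beta> assume "(\<alpha>, \<beta>) \<in> S"
    then obtain a1 a2 b1 b2 c1 where
      "first_integral (rhs_u \<alpha>) (rhs_v \<beta>) (ansatz a1 a2 b1 b2 c1)"
      unfolding S_def by blast
    from parameters_of_first_integral[OF two this[unfolded rhs_u_eq rhs_v_eq ansatz_eq]]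
    show "(\<alpha>, \<beta>) \<in> ?P"
      by (simp only: insert_iff empty_iff prod.inject c_eq)
  next
    \<comment> \<open>All witnesses are integers, so they can be taken as images of complex numbers;
      the rules \<open>c\<close> then turn each goal into an instance of
      \<open>first_integral_cases\<close>.\<close>
    have witness: "(\<alpha>, \<beta>) \<in> S"
      if "first_integral (normal_rhs_u (?c \<alpha>) [:0, 1:] [:kappa2:])
        (normal_rhs_v (?c \<beta>) [:0, 1:] [:kappa3:])
        (normal_ansatz [:0, 1:] [:kappa2:] [:kappa3:]
          (?c a1) (?c a2) (?c b1) (?c b2) (?c c1))" for \<alpha> \<beta> a1 a2 b1 b2 c1
      using that[folded rhs_u_eq rhs_v_eq ansatz_eq] unfolding S_def by blast
    have "(-2, -1) \<in> S"
      by (rule witness[of _ _ 0 1 0 0 0]) (simp only: c first_integral_cases)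
    moreover have "(-2, 0) \<in> S"
      by (rule witness[of _ _ 0 1 0 "- 1" 0]) (simp only: c first_integral_cases)
    moreover have "(-1, -2) \<in> S"
      by (rule witness[of _ _ 0 0 "- 1" 0 "- 2"]) (simp only: c first_integral_cases)
    moreover have "(-1, 0) \<in> S"
      by (rule witness[of _ _ 0 0 0 "- 1" 0]) (simp only: c first_integral_cases)
    moreover have "(0, -2) \<in> S"
      by (rule witness[of _ _ 1 0 "- 1" 0 "- 2"]) (simp only: c first_integral_cases)
    moreover have "(0, -1) \<in> S"
      by (rule witness[of _ _ 1 0 0 0 "- 2"]) (simp only: c first_integral_cases)
    ultimately show "(\<alpha>, \<beta>) \<in> S" if "(\<alpha>, \<beta>) \<in> ?P" for \<alpha> \<beta>
      using that by auto
  qed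
  then show ?thesis by simp
qed

end
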